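(* Let $G$ be a weighted undirected graph on $N$ vertices, let $T\ge 1$, and let $\boldsymbol{X}$ be a joint time-vertex process on $G$ with $T$ time-steps, with vectorized form $\boldsymbol{x}=\mathrm{vec}(\boldsymbol{X})$ and covariance matrix $\boldsymbol{\Sigma}_{\boldsymbol{x}}=\mathbb{E}[\boldsymbol{x}\boldsymbol{x}^*]-\mathbb{E}[\boldsymbol{x}]\mathbb{E}[\boldsymbol{x}^*]$. Then $\boldsymbol{X}$ is jointly wide-sense stationary (JWSS) if and only if both of the following hold: 1) $\boldsymbol{L}_J\,\mathbb{E}[\boldsymbol{x}]=\boldsymbol{0}_{NT}$; 2) $\boldsymbol{\Sigma}_{\boldsymbol{x}}$ is diagonalizable by the joint Fourier basis $\boldsymbol{U}_J$, i.e. $\boldsymbol{U}_J^*\,\boldsymbol{\Sigma}_{\boldsymbol{x}}\,\boldsymbol{U}_J$ is a diagonal matrix.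
   Context: Graph. $G$ has vertices $v_1,\dots,v_N$ and symmetric weighted adjacency matrix $\boldsymbol{W}_G$ (nonnegative weights). Its combinatorial Laplacian is $\boldsymbol{L}_G=\mathrm{diag}(\boldsymbol{W}_G\boldsymbol{1}_N)-\boldsymbol{W}_G=\boldsymbol{U}_G\boldsymbol{\Lambda}_G\boldsymbol{U}_G^*$, where $\boldsymbol{U}_G$ is the (unitary) eigenvector matrix and $\boldsymbol{\Lambda}_G=\mathrm{diag}(\lambda_1,\dots,\lambda_N)$. $(\cdot)^*$ is the conjugate transpose. Time. $\boldsymbol{U}_T$ is the $T\times T$ unitary Fourier basis, $[\boldsymbol{U}_T]_{t,\tau}=T^{-1/2}e^{2\pi j(\tau-1)t/T}$ with $j=\sqrt{-1}$; the angular frequencies are $\omega_\tau=2\pi(\tau-1)/T$, $\tau=1,\dots,T$. The time Laplacian (cycle graph) is $\boldsymbol{L}_T=\boldsymbol{U}_T\,\mathrm{diag}(1-\cos\omega_1,\dots,1-\cos\omega_T)\,\boldsymbol{U}_T^*$. Joint objects. $\boldsymbol{U}_J=\boldsymbol{U}_T\otimes\boldsymbol{U}_G$ (Kronecker product, an $NT\times NT$ unitary matrix) is the joint Fourier basis. The joint Laplacian is $\boldsymbol{L}_J=\boldsymbol{L}_T\otimes\boldsymbol{I}_N+\boldsymbol{I}_T\otimes\boldsymbol{L}_G$. For a function $h:\mathbb{R}_+\times\mathbb{R}\to\mathbb{R}$, the joint filter $h(\boldsymbol{L}_J)$ is the matrix $h(\boldsymbol{L}_J)=\boldsymbol{U}_J\,h(\boldsymbol{\Lambda}_G,\boldsymbol{\Omega})\,\boldsymbol{U}_J^*$,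 where $h(\boldsymbol{\Lambda}_G,\boldsymbol{\Omega})$ is the $NT\times NT$ diagonal matrix with $k$-th diagonal entry $h(\lambda_n,\omega_\tau)$ for $k=N(\tau-1)+n$. Joint localization of $h$ at vertex $i$ and time $t$ is $\mathcal{T}^J_{i,t}h=\mathrm{mat}\big(h(\boldsymbol{L}_J)(\boldsymbol{\delta}_t\otimes\boldsymbol{\delta}_i)\big)\in\mathbb{C}^{N\times T}$, where $\boldsymbol{\delta}_t\in\mathbb{R}^T$, $\boldsymbol{\delta}_i\in\mathbb{R}^N$ are Kronecker deltas (standard basis vectors), $\mathrm{vec}$ stacks the columns of an $N\times T$ matrix, and $\mathrm{mat}$ is the inverse of $\mathrm{vec}$. Processes. A joint time-vertex process is a random matrix $\boldsymbol{X}\in\mathbb{R}^{N\times T}$ with finite second moments, with rows indexed by vertices and columns by time. JWSS. $\boldsymbol{X}$ is jointly wide-sense stationary (JWSS) if and only if $\boldsymbol{x}=\mathrm{vec}(\boldsymbol{X})$ satisfies: (1) $\boldsymbol{L}_J\,\mathbb{E}[\boldsymbol{x}]=\boldsymbol{0}_{NT}$; (2) there exists a joint filter $h(\boldsymbol{L}_J)$ such that for all $i\in\{1,\dots,N\}$, $t\in\{1,\dots,T\}$, the $k$-th row of $\boldsymbol{\Sigma}_{\boldsymbol{x}}$ with $k=N(t-1)+i$ equals $\mathrm{vec}(\mathcal{T}^J_{i,t}h)$ (as a vector of length $NT$).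
   Formalization: With repeated eigenvalues of L_G, a covariance diagonal in one fixed U_J need not be JWSS; so condition 2 is required for U_T⊗V with every eigenvector matrix V of L_G, and the equivalence for the given U_J alone is stated when the eigenvalues of L_G are pairwise distinct. *)

theory Defs
  imports "HOL-Probability.Probability" "Jordan_Normal_Form.Schur_Decomposition"
begin

unbundle no vec_syntax
no_notation inner (infixl "\<bullet>" 70)
hide_const (open) Finite_Cartesian_Product.vec Finite_Cartesian_Product.mat
  Finite_Cartesian_Product.row Finite_Cartesian_Product.column
hide_type (open) Finite_Cartesian_Product.vec

text \<open>
  Vertices, time steps and frequencies are numbered from 0: vertex \<open>i < N\<close>, time \<open>t < T\<close> and
  frequency \<open>\<tau> < T\<close> stand for the mathematical indices \<open>i + 1\<close>, \<open>t + 1\<close>, \<open>\<tau> + 1\<close>. The joint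
  index \<open>N (t - 1) + i\<close> of the 1-based numbering becomes \<open>N * t + i\<close>.
\<close>

subsection \<open>Kronecker products and vectorization\<close>

definition kron_mat :: "'a::times mat \<Rightarrow> 'a mat \<Rightarrow> 'a mat" where
  "kron_mat A B = mat (dim_row A * dim_row B) (dim_col A * dim_col B)
     (\<lambda>(k, l). A $$ (k div dim_row B, l div dim_col B) * B $$ (k mod dim_row B, l mod dim_col B))"

definition kron_vec :: "'a::times vec \<Rightarrow> 'a vec \<Rightarrow> 'a vec" where
  "kron_vec u v = vec (dim_vec u * dim_vec v) (\<lambda>k. u $ (k div dim_vec v) * v $ (k mod dim_vec v))"

definition vectorize :: "'a mat \<Rightarrow> 'a vec" where
  "vectorize A = vec (dim_row A * dim_col A) (\<lambda>k. A $$ (k mod dim_row A, k div dim_row A))"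

definition unvectorize :: "nat \<Rightarrow> nat \<Rightarrow> 'a vec \<Rightarrow> 'a mat" where
  "unvectorize N T v = mat N T (\<lambda>(i, t). v $ (N * t + i))"

definition unitary_mat :: "nat \<Rightarrow> complex mat \<Rightarrow> bool" where
  "unitary_mat n U \<longleftrightarrow> U \<in> carrier_mat n n \<and> U * mat_adjoint U = 1\<^sub>m n \<and> mat_adjoint U * U = 1\<^sub>m n"


subsection \<open>Graph\<close>

definition adjacency_matrix :: "nat \<Rightarrow> real mat \<Rightarrow> bool" where
  "adjacency_matrix N W \<longleftrightarrow> W \<in> carrier_mat N N \<and> transpose_mat W = W \<and>
     (\<forall>i<N. \<forall>j<N. W $$ (i, j) \<ge> 0)"

definition graph_laplacian :: "real mat \<Rightarrow> complex mat" where
  "graph_laplacian W = map_mat complex_of_real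
     (mat_diag (dim_row W) (\<lambda>i. (W *\<^sub>v vec (dim_col W) (\<lambda>_. 1)) $ i) - W)"

text \<open>
  The eigendecomposition is a predicate because the eigenvector matrix is not determined by the
  Laplacian: columns may be rescaled by phases, permuted together with the eigenvalues, and rotated
  inside eigenspaces of dimension greater than 1.
\<close>

definition graph_fourier_basis :: "real mat \<Rightarrow> complex mat \<Rightarrow> (nat \<Rightarrow> real) \<Rightarrow> bool" where
  "graph_fourier_basis W U lam \<longleftrightarrow> unitary_mat (dim_row W) U \<and>
     graph_laplacian W = U * mat_diag (dim_row W) (\<lambda>n. complex_of_real (lam n)) * mat_adjoint U"


subsection \<open>Time\<close>

definition angular_frequency :: "nat \<Rightarrow> nat \<Rightarrow> real" where
  "angular_frequency T \<tau> = 2 * pi * real \<tau> / real T"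

text \<open>
  The row index enters the exponent with its 1-based value, hence \<open>t + 1\<close>; the column index
  enters as the 1-based value minus 1, hence \<open>\<tau>\<close>.
\<close>

definition time_fourier_basis :: "nat \<Rightarrow> complex mat" where
  "time_fourier_basis T = mat T T (\<lambda>(t, \<tau>).
     complex_of_real (1 / sqrt (real T)) *
     exp (2 * complex_of_real pi * \<i> * of_nat \<tau> * of_nat (t + 1) / of_nat T))"

definition time_laplacian :: "nat \<Rightarrow> complex mat" where
  "time_laplacian T = time_fourier_basis T *
     mat_diag T (\<lambda>\<tau>. complex_of_real (1 - cos (angular_frequency T \<tau>))) *
     mat_adjoint (time_fourier_basis T)"


subsection \<open>Joint Fourier basis, Laplacian, filters and localization\<close>

definition joint_fourier_basis :: "nat \<Rightarrow> complex mat \<Rightarrow> complex mat" where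
  "joint_fourier_basis T U = kron_mat (time_fourier_basis T) U"

definition joint_laplacian :: "nat \<Rightarrow> real mat \<Rightarrow> complex mat" where
  "joint_laplacian T W = kron_mat (time_laplacian T) (1\<^sub>m (dim_row W)) +
     kron_mat (1\<^sub>m T) (graph_laplacian W)"

text \<open>
  A filter kernel is only ever evaluated at eigenvalues of the graph Laplacian. As these are
  nonnegative, a total function on the reals is the same as one whose first argument ranges over
  the nonnegative reals.
\<close>

definition joint_filter ::
  "nat \<Rightarrow> complex mat \<Rightarrow> (nat \<Rightarrow> real) \<Rightarrow> (real \<Rightarrow> real \<Rightarrow> real) \<Rightarrow> complex mat" where
  "joint_filter T U lam h = (let N = dim_row U in
     joint_fourier_basis T U *
     mat_diag (N * T) (\<lambda>k. complex_of_real (h (lam (k mod N)) (angular_frequency T (k div N)))) *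
     mat_adjoint (joint_fourier_basis T U))"

definition joint_localization ::
  "nat \<Rightarrow> complex mat \<Rightarrow> (nat \<Rightarrow> real) \<Rightarrow> (real \<Rightarrow> real \<Rightarrow> real) \<Rightarrow> nat \<Rightarrow> nat \<Rightarrow> complex mat" where
  "joint_localization T U lam h i t = (let N = dim_row U in
     unvectorize N T (joint_filter T U lam h *\<^sub>v kron_vec (unit_vec T t) (unit_vec N i)))"


subsection \<open>Joint time-vertex processes\<close>

definition time_vertex_process :: "'a measure \<Rightarrow> nat \<Rightarrow> nat \<Rightarrow> ('a \<Rightarrow> real mat) \<Rightarrow> bool" where
  "time_vertex_process M N T X \<longleftrightarrow> prob_space M \<and>
     (\<forall>\<omega>\<in>space M. X \<omega> \<in> carrier_mat N T) \<and>
     (\<forall>i<N. \<forall>t<T. (\<lambda>\<omega>. X \<omega> $$ (i, t)) \<in> borel_measurable M \<and>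
        integrable M (\<lambda>\<omega>. (X \<omega> $$ (i, t))\<^sup>2))"

definition vec_process :: "('a \<Rightarrow> real mat) \<Rightarrow> 'a \<Rightarrow> real vec" where
  "vec_process X = (\<lambda>\<omega>. vectorize (X \<omega>))"

definition mean_vec :: "'a measure \<Rightarrow> nat \<Rightarrow> ('a \<Rightarrow> real vec) \<Rightarrow> complex vec" where
  "mean_vec M n x = vec n (\<lambda>k. complex_of_real (\<integral>\<omega>. x \<omega> $ k \<partial>M))"

text \<open>The vector \<open>x\<close> is real, so no conjugation is needed in the outer products.\<close>

definition covariance_mat :: "'a measure \<Rightarrow> nat \<Rightarrow> ('a \<Rightarrow> real vec) \<Rightarrow> complex mat" where
  "covariance_mat M n x = mat n n (\<lambda>(k, l). complex_of_real
     ((\<integral>\<omega>. x \<omega> $ k * x \<omega> $ l \<partial>M) - (\<integral>\<omega>. x \<omega> $ k \<partial>M) * (\<integral>\<omega>. x \<omega> $ l \<partial>M)))"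

definition jwss :: "'a measure \<Rightarrow> nat \<Rightarrow> nat \<Rightarrow> real mat \<Rightarrow> complex mat \<Rightarrow> (nat \<Rightarrow> real) \<Rightarrow>
    ('a \<Rightarrow> real mat) \<Rightarrow> bool" where
  "jwss M N T W U lam X \<longleftrightarrow> (let x = vec_process X in
     joint_laplacian T W *\<^sub>v mean_vec M (N * T) x = 0\<^sub>v (N * T) \<and>
     (\<exists>h. \<forall>i<N. \<forall>t<T. row (covariance_mat M (N * T) x) (N * t + i) =
        vectorize (joint_localization T U lam h i t)))"

text \<open>
  For graphs with repeated Laplacian eigenvalues, being diagonalized by the joint Fourier basis
  depends on which eigenvector matrix was chosen, whereas \<open>jwss\<close> does not. For instance, two
  isolated vertices, \<open>T = 1\<close>, \<open>U = 1\<^sub>m 2\<close> and covariance diag(1, 2): the covariance is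
  diagonal in this basis, but every joint filter is a multiple of the identity.
\<close>

definition diagonalized_by :: "complex mat \<Rightarrow> complex mat \<Rightarrow> bool" where
  "diagonalized_by U A \<longleftrightarrow> diagonal_mat (mat_adjoint U * A * U)"

end

theory Submission
  imports Defs
begin

text \<open>
  The covariance matrix is real symmetric, so the localization condition on its rows says that it
  equals the joint filter, i.e. that its conjugate by the joint Fourier basis is a diagonal matrix
  whose entries are real and depend only on the eigenvalue and the frequency. Hermitian symmetry
  gives realness; distinct frequencies are automatic, so only repeated graph eigenvalues matter.
  Two eigenbases of the graph differ by a unitary \<open>Q\<close> that vanishes between distinct eigenvalues,
  so \<open>Q\<close> carries the filter in one basis to the same filter in the other. Conversely, if two
  eigenvalues coincide, reflecting the corresponding eigenvectors gives another eigenbasis, and a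
  matrix that is diagonal in both has equal entries at the two positions.
\<close>

subsection \<open>Adjoints and unitary matrices\<close>

lemma mat_adjoint_dim [simp]:
  "dim_row (mat_adjoint A) = dim_col A" "dim_col (mat_adjoint A) = dim_row A"
  by (auto simp: mat_adjoint_def)

lemma mat_adjoint_carrier [simp]:
  "A \<in> carrier_mat m n \<Longrightarrow> mat_adjoint A \<in> carrier_mat n m"
  unfolding carrier_mat_def by simp

lemma mat_adjoint_index:
  assumes "i < dim_col A" "j < dim_row A"
  shows "mat_adjoint A $$ (i, j) = conjugate (A $$ (j, i))"
  using assms by (simp add: mat_adjoint_def mat_of_rows_index)

lemma mat_adjoint_mult:
  fixes A B :: "complex mat"
  assumes "A \<in> carrier_mat m n" "B \<in> carrier_mat n p"
  shows "mat_adjoint (A * B) = mat_adjoint B * mat_adjoint A"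
  using assms
  by (intro eq_matI) (auto simp: mat_adjoint_index scalar_prod_def mult.commute intro!: sum.cong)

lemma mat_adjoint_adjoint [simp]: "mat_adjoint (mat_adjoint A) = A"
  by (intro eq_matI) (auto simp: mat_adjoint_index)

lemma unitary_matD:
  assumes "unitary_mat n U"
  shows "U \<in> carrier_mat n n" "mat_adjoint U \<in> carrier_mat n n"
    "U * mat_adjoint U = 1\<^sub>m n" "mat_adjoint U * U = 1\<^sub>m n"
  using assms unfolding unitary_mat_def by auto

text \<open>A one-sided inverse of a square matrix over a field is two-sided, so orthonormality of
  the columns suffices.\<close>

lemma unitary_matI:
  assumes "U \<in> carrier_mat n n" "mat_adjoint U * U = 1\<^sub>m n"
  shows "unitary_mat n U"
  using assms mat_mult_left_right_inverse[of "mat_adjoint U" n U]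
  unfolding unitary_mat_def by auto

lemma unitary_mat_adjoint:
  "unitary_mat n U \<Longrightarrow> unitary_mat n (mat_adjoint U)"
  unfolding unitary_mat_def by auto

lemma unitary_mat_mult:
  assumes "unitary_mat n U" "unitary_mat n V"
  shows "unitary_mat n (U * V)"
proof (rule unitary_matI)
  note U = unitary_matD[OF assms(1)] and V = unitary_matD[OF assms(2)]
  show "U * V \<in> carrier_mat n n" using U V by auto
  \<comment> \<open>Associativity of matrix products is conditional on dimensions; the carrier facts
    let both sides be rebracketed to the same right-nested product.\<close>
  have "mat_adjoint (U * V) * (U * V) = mat_adjoint V * (mat_adjoint U * U) * V"
    by (simp only: mat_adjoint_mult[of _ n n _ n] assoc_mult_mat[of _ n n _ n _ n] U(1,2) V(1,2)
        mult_carrier_mat[of _ n n _ n])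
  then show "mat_adjoint (U * V) * (U * V) = 1\<^sub>m n" using U V by simp
qed

text \<open>Converts the synthesis form in which filters are defined into a statement about the
  conjugated matrix, where being diagonal is visible.\<close>

lemma unitary_conj_iff:
  assumes "unitary_mat n U" and [simp]: "A \<in> carrier_mat n n" "D \<in> carrier_mat n n"
  shows "A = U * D * mat_adjoint U \<longleftrightarrow> mat_adjoint U * A * U = D"
proof -
  note U = unitary_matD[OF assms(1)]
  have "mat_adjoint U * (U * D * mat_adjoint U) * U
      = (mat_adjoint U * U) * D * (mat_adjoint U * U)"
    by (simp only: assoc_mult_mat[of _ n n _ n _ n] U(1,2) assms(2,3) mult_carrier_mat[of _ n n _ n])
  moreover have "U * (mat_adjoint U * A * U) * mat_adjoint U
      = (U * mat_adjoint U) * A * (U * mat_adjoint U)"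
    by (simp only: assoc_mult_mat[of _ n n _ n _ n] U(1,2) assms(2,3) mult_carrier_mat[of _ n n _ n])
  ultimately show ?thesis using assms(2,3) U(3,4) by (metis left_mult_one_mat right_mult_one_mat)
qed

section \<open>Diagonal matrices\<close>

lemma mat_diag_index [simp]:
  "i < n \<Longrightarrow> j < n \<Longrightarrow> mat_diag n f $$ (i, j) = (if i = j then f j else 0)"
  by (simp add: mat_diag_def)

lemma mat_diag_dims [simp]: "dim_row (mat_diag n f) = n" "dim_col (mat_diag n f) = n"
  by (auto simp: mat_diag_def)

lemma diagonal_mat_eq_mat_diag:
  assumes "A \<in> carrier_mat n n" "diagonal_mat A"
  shows "A = mat_diag n (\<lambda>i. A $$ (i, i))"
  using assms by (intro eq_matI) (auto simp: diagonal_mat_def)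

lemma diagonal_mat_mat_diag: "diagonal_mat (mat_diag n f)"
  by (auto simp: diagonal_mat_def)

subsection \<open>Kronecker products\<close>

lemma joint_index_less:
  assumes "i < N" "t < (T :: nat)"
  shows "N * t + i < N * T"
proof -
  have "N * t + i < N * Suc t" using assms by simp
  also have "\<dots> \<le> N * T" using assms by (intro mult_le_mono2) auto
  finally show ?thesis .
qed

lemma joint_index_div_mod [simp]:
  fixes i N t :: nat
  assumes "i < N"
  shows "(N * t + i) div N = t" "(N * t + i) mod N = i"
  using assms by auto

lemma joint_index_cases:
  assumes "k < N * (T :: nat)"
  obtains i t where "i < N" "t < T" "k = N * t + i"
proof
  \<comment> \<open>For \<open>N = 0\<close> the bound on \<open>k\<close> is contradictory.\<close>
  show "k mod N < N" using assms by (cases N) auto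
  show "k div N < T" using assms by (simp add: less_mult_imp_div_less mult.commute)
  show "k = N * (k div N) + k mod N" by simp
qed

lemma sum_joint_index:
  fixes N T :: nat
  shows "(\<Sum>k<N * T. f k) = (\<Sum>t<T. \<Sum>i<N. f (N * t + i))"
proof -
  have "(\<Sum>k<N * T. f k) = (\<Sum>t<T. \<Sum>k\<in>{t * N..<t * N + N}. f k)"
    by (simp add: sum.nat_group mult.commute)
  also have "\<dots> = (\<Sum>t<T. \<Sum>i<N. f (N * t + i))"
  proof (rule sum.cong[OF refl])
    show "(\<Sum>k\<in>{t * N..<t * N + N}. f k) = (\<Sum>i<N. f (N * t + i))" for t
      using sum.shift_bounds_nat_ivl[of f 0 "t * N" N]
      by (simp add: atLeast0LessThan add.commute mult.commute)
  qed
  finally show ?thesis .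
qed

lemma kron_mat_carrier [simp]:
  "A \<in> carrier_mat a b \<Longrightarrow> B \<in> carrier_mat c d \<Longrightarrow> kron_mat A B \<in> carrier_mat (a * c) (b * d)"
  by (auto simp: kron_mat_def)

lemma kron_mat_dims [simp]:
  "dim_row (kron_mat A B) = dim_row A * dim_row B" "dim_col (kron_mat A B) = dim_col A * dim_col B"
  by (auto simp: kron_mat_def)

text \<open>Writing each index as block plus offset removes \<open>div\<close> and
  \<open>mod\<close>; later entry computations with Kronecker products go through this form.\<close>

lemma kron_mat_index:
  assumes "t < dim_row A" "s < dim_col A" "i < dim_row B" "j < dim_col B"
  shows "kron_mat A B $$ (dim_row B * t + i, dim_col B * s + j) = A $$ (t, s) * B $$ (i, j)"
  using assms joint_index_less[of i "dim_row B" t "dim_row A"]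
    joint_index_less[of j "dim_col B" s "dim_col A"]
  by (simp add: kron_mat_def mult.commute)

text \<open>The summation index splits into block and offset, and the resulting double sum factors;
  commutativity of the entries lets those of \<open>B\<close> move past those of
  \<open>C\<close>.\<close>

lemma kron_mat_mult:
  fixes A B C D :: "'a::comm_semiring_0 mat"
  assumes "A \<in> carrier_mat a b" "C \<in> carrier_mat b c" "B \<in> carrier_mat p q" "D \<in> carrier_mat q r"
  shows "kron_mat A B * kron_mat C D = kron_mat (A * C) (B * D)"
proof (rule eq_matI)
  show "dim_row (kron_mat A B * kron_mat C D) = dim_row (kron_mat (A * C) (B * D))"
    "dim_col (kron_mat A B * kron_mat C D) = dim_col (kron_mat (A * C) (B * D))"
    using assms by auto
  fix k l assume "k < dim_row (kron_mat (A * C) (B * D))" "l < dim_col (kron_mat (A * C) (B * D))"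
  then have "k < p * a" "l < r * c" using assms by (auto simp: mult.commute)
  then obtain i t j s where k: "i < p" "t < a" "k = p * t + i" and l: "j < r" "s < c" "l = r * s + j"
    by (metis joint_index_cases)
  have lt: "p * t + i < p * a" "r * s + j < r * c" using k l by (auto intro: joint_index_less)
  have "(kron_mat A B * kron_mat C D) $$ (k, l)
      = (\<Sum>m<q * b. kron_mat A B $$ (k, m) * kron_mat C D $$ (m, l))"
    using assms lt k l by (simp add: scalar_prod_def atLeast0LessThan mult.commute)
  also have "\<dots> = (\<Sum>u<b. \<Sum>v<q. (A $$ (t, u) * B $$ (i, v)) * (C $$ (u, s) * D $$ (v, j)))"
    unfolding sum_joint_index k l
    using assms k l kron_mat_index[of t A _ i B] kron_mat_index[of _ C s _ D j]
    by (intro sum.cong) auto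
  also have "\<dots> = (\<Sum>u<b. A $$ (t, u) * C $$ (u, s)) * (\<Sum>v<q. B $$ (i, v) * D $$ (v, j))"
    by (simp add: sum_product ac_simps)
  also have "\<dots> = kron_mat (A * C) (B * D) $$ (k, l)"
    using assms k l kron_mat_index[of t "A * C" s i "B * D" j]
    by (simp add: scalar_prod_def atLeast0LessThan)
  finally show "(kron_mat A B * kron_mat C D) $$ (k, l) = kron_mat (A * C) (B * D) $$ (k, l)" .
qed

lemma kron_mat_adjoint:
  fixes A B :: "complex mat"
  shows "mat_adjoint (kron_mat A B) = kron_mat (mat_adjoint A) (mat_adjoint B)"
proof (rule eq_matI)
  fix k l
  assume "k < dim_row (kron_mat (mat_adjoint A) (mat_adjoint B))"
    "l < dim_col (kron_mat (mat_adjoint A) (mat_adjoint B))"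
  then have *: "k < dim_col B * dim_col A" "l < dim_row B * dim_row A" by (auto simp: mult.commute)
  from *(1) obtain i t where k: "i < dim_col B" "t < dim_col A" "k = dim_col B * t + i"
    by (rule joint_index_cases)
  from *(2) obtain j s where l: "j < dim_row B" "s < dim_row A" "l = dim_row B * s + j"
    by (rule joint_index_cases)
  show "mat_adjoint (kron_mat A B) $$ (k, l) = kron_mat (mat_adjoint A) (mat_adjoint B) $$ (k, l)"
    using * k l kron_mat_index[of s A t j B i]
      kron_mat_index[of t "mat_adjoint A" s i "mat_adjoint B" j]
    by (simp add: mat_adjoint_index mult.commute)
qed auto

lemma kron_mat_one:
  "kron_mat (1\<^sub>m m) (1\<^sub>m n) = (1\<^sub>m (m * n) :: 'a::semiring_1 mat)"
proof (rule eq_matI)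
  fix k l assume "k < dim_row (1\<^sub>m (m * n) :: 'a mat)" "l < dim_col (1\<^sub>m (m * n) :: 'a mat)"
  then have "k < n * m" "l < n * m" by (auto simp: mult.commute)
  then obtain i t j s where k: "i < n" "t < m" "k = n * t + i" and l: "j < n" "s < m" "l = n * s + j"
    by (metis joint_index_cases)
  have "n * t + i = n * s + j \<longleftrightarrow> i = j \<and> t = s"
    using k l by (metis joint_index_div_mod)
  then show "kron_mat (1\<^sub>m m) (1\<^sub>m n) $$ (k, l) = (1\<^sub>m (m * n) :: 'a mat) $$ (k, l)"
    using k l \<open>k < n * m\<close> \<open>l < n * m\<close> kron_mat_index[of t "1\<^sub>m m :: 'a mat" s i "1\<^sub>m n" j]
    by (auto simp: mult.commute)
qed auto

lemma unitary_kron_mat: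
  assumes "unitary_mat m A" "unitary_mat n B"
  shows "unitary_mat (m * n) (kron_mat A B)"
  using unitary_matD[OF assms(1)] unitary_matD[OF assms(2)]
  by (intro unitary_matI) (auto simp: kron_mat_adjoint kron_mat_mult[of _ m m _ m _ n n _ n] kron_mat_one)

subsection \<open>The Fourier basis\<close>

text \<open>Each column is a geometric progression in a T-th root of unity. The inner product of two
  distinct columns is a geometric sum whose ratio is a nontrivial T-th root of unity, hence
  zero.\<close>

lemma unitary_time_fourier_basis:
  assumes "T \<ge> 1"
  shows "unitary_mat T (time_fourier_basis T)"
proof (rule unitary_matI)
  define z where "z = (\<lambda>\<tau>. exp (2 * complex_of_real pi * \<i> * of_nat \<tau> / of_nat T))"
  show F: "time_fourier_basis T \<in> carrier_mat T T" by (simp add: time_fourier_basis_def)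
  \<comment> \<open>The exponent \<open>Suc t\<close> is the 1-based row index. Compared with
    \<open>t\<close> it only multiplies each column by a phase.\<close>
  have entry: "time_fourier_basis T $$ (t, \<tau>) = of_real (1 / sqrt T) * z \<tau> ^ Suc t"
    if "t < T" "\<tau> < T" for t \<tau>
  proof -
    have "z \<tau> ^ Suc t = exp (of_nat (Suc t) * (2 * complex_of_real pi * \<i> * of_nat \<tau> / of_nat T))"
      by (simp only: z_def exp_of_nat_mult)
    then show ?thesis
      using that by (simp add: time_fourier_basis_def mult_ac del: power_Suc of_nat_Suc)
  qed
  have zT: "z \<tau> ^ T = 1" for \<tau>
    using assms exp_integer_2pi[of "of_nat \<tau>"]
    by (simp add: z_def exp_of_nat_mult[symmetric] mult_ac)
  have zn: "z \<tau> \<noteq> 0" "cnj (z \<tau>) = inverse (z \<tau>)" for \<tau>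
    by (auto simp: z_def exp_cnj exp_minus[symmetric])
  have orth: "(\<Sum>t<T. cnj (z \<sigma>) ^ Suc t * z \<tau> ^ Suc t) = (if \<sigma> = \<tau> then of_nat T else 0)"
    if "\<sigma> < T" "\<tau> < T" for \<sigma> \<tau>
  proof (cases "\<sigma> = \<tau>")
    case True
    have "cnj (z \<tau>) ^ Suc t * z \<tau> ^ Suc t = 1" for t
      by (simp only: zn left_inverse power_one not_False_eq_True flip: power_mult_distrib)
    then show ?thesis using True by (simp del: power_Suc)
  next
    case False
    define r where "r = z \<tau> / z \<sigma>"
    \<comment> \<open>Two such roots agree only if their exponents are congruent modulo
      \<open>T\<close>, which distinct numbers below \<open>T\<close> are not.\<close>
    have "z \<tau> \<noteq> z \<sigma>"
      using False that assms complex_root_unity_eq[of T \<tau> \<sigma>]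
      by (auto simp: z_def cong_def)
    then have "r \<noteq> 1" using zn by (simp add: r_def)
    moreover have "r ^ T = 1" by (simp add: r_def power_divide zT)
    ultimately have "(\<Sum>t<T. r ^ t) = 0" by (simp add: geometric_sum)
    \<comment> \<open>Conjugation inverts a unimodular number, so each term is a power of
      \<open>r\<close>; the shifted exponent leaves one factor \<open>r\<close> in front.\<close>
    moreover have "(\<Sum>t<T. cnj (z \<sigma>) ^ Suc t * z \<tau> ^ Suc t) = r * (\<Sum>t<T. r ^ t)"
      unfolding sum_distrib_left
      by (intro sum.cong) (simp_all add: zn r_def power_divide divide_inverse power_mult_distrib power_inverse)
    ultimately show ?thesis using False by simp
  qed
  show "mat_adjoint (time_fourier_basis T) * time_fourier_basis T = 1\<^sub>m T"
  proof (rule eq_matI)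
    fix \<sigma> \<tau> assume "\<sigma> < dim_row (1\<^sub>m T :: complex mat)" "\<tau> < dim_col (1\<^sub>m T :: complex mat)"
    then have st: "\<sigma> < T" "\<tau> < T" by auto
    have "(mat_adjoint (time_fourier_basis T) * time_fourier_basis T) $$ (\<sigma>, \<tau>)
        = (\<Sum>t<T. of_real (1 / sqrt T) * of_real (1 / sqrt T) * (cnj (z \<sigma>) ^ Suc t * z \<tau> ^ Suc t))"
      using F st by (auto simp: scalar_prod_def atLeast0LessThan mat_adjoint_index entry intro!: sum.cong)
    also have "\<dots> = of_real (1 / T) * (if \<sigma> = \<tau> then of_nat T else 0)"
      unfolding sum_distrib_left[symmetric] orth[OF st] of_real_mult[symmetric] by simp
    finally show "(mat_adjoint (time_fourier_basis T) * time_fourier_basis T) $$ (\<sigma>, \<tau>) = 1\<^sub>m T $$ (\<sigma>, \<tau>)"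
      using st assms by simp
  qed (use F in auto)
qed


lemma unitary_joint_fourier_basis:
  assumes "T \<ge> 1" "unitary_mat N U"
  shows "unitary_mat (N * T) (joint_fourier_basis T U)"
  using unitary_kron_mat[OF unitary_time_fourier_basis[OF assms(1)] assms(2)]
  by (simp add: joint_fourier_basis_def mult.commute)

text \<open>The time factors cancel by unitarity, so changing the graph basis acts separately, and
  identically, at each frequency.\<close>

lemma adjoint_joint_fourier_basis_mult:
  assumes "T \<ge> 1" "unitary_mat N U" "unitary_mat N V"
  shows "mat_adjoint (joint_fourier_basis T V) * joint_fourier_basis T U
    = kron_mat (1\<^sub>m T) (mat_adjoint V * U)"
proof -
  note F = unitary_matD[OF unitary_time_fourier_basis[OF assms(1)]]
  show ?thesis
    unfolding joint_fourier_basis_def kron_mat_adjoint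
    using F unitary_matD[OF assms(2)] unitary_matD[OF assms(3)]
    by (simp add: kron_mat_mult[of _ T T _ T _ N N _ N])
qed

lemma inj_on_angular_frequency: "inj_on (angular_frequency T) {..<T}"
  by (auto simp: inj_on_def angular_frequency_def)

subsection \<open>Joint filters\<close>

text \<open>Prescribed values define a function exactly when equal arguments carry equal values.
  Since frequencies determine \<tau>, only coincidences of eigenvalues within one \<tau>
  matter.\<close>

lemma filter_kernel_exists_iff:
  "(\<exists>h. \<forall>\<tau><T. \<forall>n<N. h (lam n) (angular_frequency T \<tau>) = d (N * \<tau> + n)) \<longleftrightarrow>
    (\<forall>\<tau><T. \<forall>n<N. \<forall>m<N. lam n = lam m \<longrightarrow> d (N * \<tau> + n) = d (N * \<tau> + m))"
  (is "?L \<longleftrightarrow> ?R")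
proof
  assume ?R
  define P where "P = (\<lambda>l w (\<tau>, n). \<tau> < T \<and> n < N \<and> lam n = l \<and> angular_frequency T \<tau> = w)"
  \<comment> \<open>The kernel reads its value off an arbitrarily chosen index pair with the given
    arguments; where no such pair exists its value is irrelevant.\<close>
  define h where "h = (\<lambda>l w. case SOME p. P l w p of (\<tau>, n) \<Rightarrow> d (N * \<tau> + n))"
  have "h (lam n) (angular_frequency T \<tau>) = d (N * \<tau> + n)" if "\<tau> < T" "n < N" for \<tau> n
  proof -
    obtain \<sigma> m where sm: "(SOME p. P (lam n) (angular_frequency T \<tau>) p) = (\<sigma>, m)"
      by fastforce
    have "P (lam n) (angular_frequency T \<tau>) (\<tau>, n)" using that by (simp add: P_def)
    from someI[of "P (lam n) (angular_frequency T \<tau>)", OF this]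
    have "\<sigma> < T" "m < N" "lam m = lam n" "angular_frequency T \<sigma> = angular_frequency T \<tau>"
      unfolding sm by (auto simp: P_def)
    moreover from this have "\<sigma> = \<tau>"
      using inj_on_angular_frequency that by (auto dest: inj_onD)
    ultimately have "d (N * \<tau> + m) = d (N * \<tau> + n)" using \<open>?R\<close> that by metis
    then show ?thesis by (simp add: h_def sm \<open>\<sigma> = \<tau>\<close>)
  qed
  then show ?L by blast
qed metis

lemma joint_filter_eq_iff:
  assumes "T \<ge> 1" "unitary_mat N U" "A \<in> carrier_mat (N * T) (N * T)"
  shows "A = joint_filter T U lam h \<longleftrightarrow>
    mat_adjoint (joint_fourier_basis T U) * A * joint_fourier_basis T U =
    mat_diag (N * T) (\<lambda>k. complex_of_real (h (lam (k mod N)) (angular_frequency T (k div N))))"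
proof -
  have "dim_row U = N" using unitary_matD[OF assms(2)] by auto
  then show ?thesis
    using unitary_conj_iff[OF unitary_joint_fourier_basis[OF assms(1,2)] assms(3)]
    by (simp add: joint_filter_def Let_def)
qed

text \<open>Diagonality is kept apart from consistency on repeated eigenvalues, so that for a simple
  spectrum the latter can simply be dropped.\<close>

lemma joint_filter_exists_iff:
  fixes A :: "complex mat" and lam :: "nat \<Rightarrow> real"
  assumes "T \<ge> 1" "unitary_mat N U" "A \<in> carrier_mat (N * T) (N * T)" "mat_adjoint A = A"
  defines "B \<equiv> mat_adjoint (joint_fourier_basis T U) * A * joint_fourier_basis T U"
  shows "(\<exists>h. A = joint_filter T U lam h) \<longleftrightarrow>
    diagonalized_by (joint_fourier_basis T U) A \<and>
    (\<forall>\<tau><T. \<forall>n<N. \<forall>m<N. lam n = lam m \<longrightarrow>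
      B $$ (N * \<tau> + n, N * \<tau> + n) = B $$ (N * \<tau> + m, N * \<tau> + m))"
    (is "?L \<longleftrightarrow> ?diag \<and> ?R")
proof -
  let ?J = "joint_fourier_basis T U" and ?n = "N * T"
  let ?D = "\<lambda>h. mat_diag ?n (\<lambda>k. complex_of_real (h (lam (k mod N)) (angular_frequency T (k div N))))"
  note J = unitary_matD[OF unitary_joint_fourier_basis[OF assms(1,2)]]
  have B: "B \<in> carrier_mat ?n ?n" using J assms(3) unfolding B_def by auto
  have "mat_adjoint B = B"
    unfolding B_def using J(1,2) assms(3,4)
    by (simp add: mat_adjoint_mult[of _ ?n ?n _ ?n] assoc_mult_mat[of _ ?n ?n _ ?n _ ?n])
  \<comment> \<open>Kernels are real-valued, so the diagonal entries must be real; self-adjointness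
    of \<open>B\<close> provides this.\<close>
  then have real: "complex_of_real (Re (B $$ (k, k))) = B $$ (k, k)" if "k < ?n" for k
    using that B mat_adjoint_index[of k B k] by (auto simp: complex_eq_iff)
  have L: "?L \<longleftrightarrow> (\<exists>h. B = ?D h)"
    using joint_filter_eq_iff[OF assms(1-3)] unfolding B_def by simp
  show ?thesis
  proof
    assume ?L
    then obtain h where h: "B = ?D h" using L by blast
    have ?diag using diagonal_mat_mat_diag h unfolding diagonalized_by_def B_def by metis
    moreover have ?R unfolding h by (auto simp: joint_index_less)
    ultimately show "?diag \<and> ?R" ..
  next
    assume *: "?diag \<and> ?R"
    then have Bd: "B = mat_diag ?n (\<lambda>k. B $$ (k, k))"
      using B by (intro diagonal_mat_eq_mat_diag) (auto simp: diagonalized_by_def B_def)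
    obtain h where h: "\<And>\<tau> n. \<tau> < T \<Longrightarrow> n < N \<Longrightarrow>
        h (lam n) (angular_frequency T \<tau>) = Re (B $$ (N * \<tau> + n, N * \<tau> + n))"
      using filter_kernel_exists_iff[of T N lam "\<lambda>k. Re (B $$ (k, k))"] * by metis
    have "B = ?D h"
    proof (subst Bd, rule eq_matI)
      fix k l assume "k < dim_row (?D h)" "l < dim_col (?D h)"
      then have "k < ?n" "l < ?n" by auto
      moreover from \<open>l < ?n\<close> obtain n \<tau> where "n < N" "\<tau> < T" "l = N * \<tau> + n"
        by (rule joint_index_cases)
      ultimately show "mat_diag ?n (\<lambda>k. B $$ (k, k)) $$ (k, l) = ?D h $$ (k, l)"
        using h real by simp
    qed auto
    then show ?L using L by blast
  qed
qed

section \<open>Localizations and rows of the covariance matrix\<close>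

lemma vectorize_unvectorize:
  assumes "dim_vec v = N * T"
  shows "vectorize (unvectorize N T v) = v"
proof (rule eq_vecI)
  fix k assume "k < dim_vec v"
  then have "k < N * T" using assms by simp
  then show "vectorize (unvectorize N T v) $ k = v $ k"
    by (elim joint_index_cases) (simp add: vectorize_def unvectorize_def joint_index_less)
qed (simp add: assms vectorize_def unvectorize_def)

lemma kron_unit_vec:
  assumes "i < N" "t < T"
  shows "kron_vec (unit_vec T t) (unit_vec N i) = (unit_vec (N * T) (N * t + i) :: 'a::semiring_1 vec)"
proof (rule eq_vecI)
  fix k assume "k < dim_vec (unit_vec (N * T) (N * t + i) :: 'a vec)"
  then have k: "k < N * T" by simp
  then obtain j s where "j < N" "s < T" "k = N * s + j" by (rule joint_index_cases)
  moreover from this have "N * s + j = N * t + i \<longleftrightarrow> s = t \<and> j = i"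
    using assms by (metis joint_index_div_mod)
  ultimately show "kron_vec (unit_vec T t) (unit_vec N i) $ k = (unit_vec (N * T) (N * t + i) :: 'a vec) $ k"
    using assms k by (auto simp: kron_vec_def unit_vec_def mult.commute)
qed (simp add: kron_vec_def mult.commute)

lemma mult_mat_unit_vec:
  fixes A :: "'a::semiring_1 mat"
  assumes "A \<in> carrier_mat m n" "k < n"
  shows "A *\<^sub>v unit_vec n k = col A k"
  using assms by (intro eq_vecI) auto

text \<open>A vectorized localization is a column of the filter matrix, while the condition speaks
  of rows of \<open>A\<close>. Plain transpose symmetry, without conjugation, turns these rows into
  columns.\<close>

lemma rows_eq_localization_iff:
  assumes "T \<ge> 1" "unitary_mat N U" "A \<in> carrier_mat (N * T) (N * T)" "transpose_mat A = A"
  shows "(\<forall>i<N. \<forall>t<T. row A (N * t + i) = vectorize (joint_localization T U lam h i t)) \<longleftrightarrow>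
    A = joint_filter T U lam h"
proof -
  let ?H = "joint_filter T U lam h"
  have U: "dim_row U = N" using unitary_matD[OF assms(2)] by auto
  have H: "?H \<in> carrier_mat (N * T) (N * T)"
    using unitary_matD[OF unitary_joint_fourier_basis[OF assms(1,2)]]
    by (auto simp: joint_filter_def Let_def U)
  have loc: "vectorize (joint_localization T U lam h i t) = col ?H (N * t + i)"
    if "i < N" "t < T" for i t
    using that H
    by (simp add: joint_localization_def Let_def U kron_unit_vec mult_mat_unit_vec
        joint_index_less vectorize_unvectorize)
  have row: "row A (N * t + i) = col A (N * t + i)" if "i < N" "t < T" for i t
    using that assms(3,4) by (metis row_transpose carrier_matD(2) joint_index_less)
  have "(\<forall>i<N. \<forall>t<T. row A (N * t + i) = vectorize (joint_localization T U lam h i t)) \<longleftrightarrow>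
      (\<forall>i<N. \<forall>t<T. col A (N * t + i) = col ?H (N * t + i))"
    using loc row by auto
  also have "\<dots> \<longleftrightarrow> (\<forall>k<N * T. col A k = col ?H k)"
    by (metis joint_index_cases joint_index_less)
  also have "\<dots> \<longleftrightarrow> A = ?H"
    using assms(3) H by (auto intro!: mat_col_eqI)
  finally show ?thesis .
qed

lemma covariance_mat_symmetric:
  shows "covariance_mat M n x \<in> carrier_mat n n"
    "transpose_mat (covariance_mat M n x) = covariance_mat M n x"
    "mat_adjoint (covariance_mat M n x) = covariance_mat M n x"
  by (auto simp: covariance_mat_def mat_adjoint_index mult.commute intro!: eq_matI)

subsection \<open>Change of the graph Fourier basis\<close>

text \<open>The change of basis \<open>Q\<close> intertwines the two diagonal eigenvalue matrices,
  hence its Kronecker extension \<open>P\<close> intertwines the diagonal filter matrices of the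
  same kernel \<open>h\<close>. The eigenvalues \<mu> may be listed in another order than
  \<open>lam\<close>.\<close>

lemma joint_filter_diagonalized:
  assumes "T \<ge> 1" "dim_row W = N"
    and "graph_fourier_basis W U lam" "graph_fourier_basis W V \<mu>"
  shows "diagonalized_by (joint_fourier_basis T V) (joint_filter T U lam h)"
proof -
  let ?n = "N * T" and ?J = "joint_fourier_basis T U" and ?K = "joint_fourier_basis T V"
  have uU: "unitary_mat N U" and uV: "unitary_mat N V"
    using assms by (auto simp: graph_fourier_basis_def)
  note U = unitary_matD[OF uU] and V = unitary_matD[OF uV]
  note J = unitary_matD[OF unitary_joint_fourier_basis[OF assms(1) uU]]
    and K = unitary_matD[OF unitary_joint_fourier_basis[OF assms(1) uV]]
  define Q where "Q = mat_adjoint V * U"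
  have Q: "Q \<in> carrier_mat N N" using U V by (auto simp: Q_def)
  define \<Lambda> where "\<Lambda> = mat_diag N (\<lambda>n. complex_of_real (lam n))"
  define \<Gamma> where "\<Gamma> = mat_diag N (\<lambda>n. complex_of_real (\<mu> n))"
  have [simp]: "\<Lambda> \<in> carrier_mat N N" "\<Gamma> \<in> carrier_mat N N" by (auto simp: \<Lambda>_def \<Gamma>_def)
  have "U * \<Lambda> * mat_adjoint U = V * \<Gamma> * mat_adjoint V"
    using assms by (simp add: graph_fourier_basis_def \<Lambda>_def \<Gamma>_def)
  then have "mat_adjoint V * (U * \<Lambda> * mat_adjoint U) * U = mat_adjoint V * (V * \<Gamma> * mat_adjoint V) * U"
    by simp
  moreover have "mat_adjoint V * (U * \<Lambda> * mat_adjoint U) * U = Q * \<Lambda> * (mat_adjoint U * U)"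
    unfolding Q_def
    by (simp only: assoc_mult_mat[of _ N N _ N _ N] U(1,2) V(1,2) mult_carrier_mat[of _ N N _ N]
        \<open>\<Lambda> \<in> _\<close>)
  moreover have "mat_adjoint V * (V * \<Gamma> * mat_adjoint V) * U = (mat_adjoint V * V) * \<Gamma> * Q"
    unfolding Q_def
    by (simp only: assoc_mult_mat[of _ N N _ N _ N] U(1,2) V(1,2) mult_carrier_mat[of _ N N _ N]
        \<open>\<Gamma> \<in> _\<close>)
  ultimately have Q\<Lambda>: "Q * \<Lambda> = \<Gamma> * Q"
    using U(4) V(4) right_mult_one_mat[OF mult_carrier_mat[OF Q \<open>\<Lambda> \<in> _\<close>]]
      left_mult_one_mat[OF \<open>\<Gamma> \<in> _\<close>] by simp
  \<comment> \<open>Entry \<open>(n, m)\<close> of the intertwining relation reads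
    \<open>Q $$ (n, m) * lam m = \<mu> n * Q $$ (n, m)\<close>; a nonzero factor cancels.\<close>
  have Q0: "\<mu> n = lam m" if "n < N" "m < N" "Q $$ (n, m) \<noteq> 0" for n m
    using that Q arg_cong[OF Q\<Lambda>, of "\<lambda>A. A $$ (n, m)"]
    by (simp add: \<Lambda>_def \<Gamma>_def mat_diag_mult_left[of _ N N] mat_diag_mult_right[of _ N N])
  define P where "P = kron_mat (1\<^sub>m T) Q"
  define d where "d = (\<lambda>\<nu> k. complex_of_real (h (\<nu> (k mod N)) (angular_frequency T (k div N))))"
  have P: "P \<in> carrier_mat ?n ?n"
    using kron_mat_carrier[OF one_carrier_mat[of T] Q] by (simp add: P_def mult.commute)
  have PJ: "P = mat_adjoint ?K * ?J"
    using adjoint_joint_fourier_basis_mult[OF assms(1) uU uV] by (simp add: P_def Q_def)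
  have PP: "P * mat_adjoint P = 1\<^sub>m ?n"
    using unitary_mat_mult[OF unitary_mat_adjoint[OF unitary_joint_fourier_basis[OF assms(1) uV]]
        unitary_joint_fourier_basis[OF assms(1) uU]] unitary_matD(3)
    by (simp add: PJ)
  have "P * mat_diag ?n (d lam) = mat_diag ?n (d \<mu>) * P"
  proof -
    \<comment> \<open>A nonzero entry of \<open>P\<close> joins equal frequencies and, by
      \<open>Q0\<close>, equal eigenvalues, so \<open>h\<close> takes the same value on both
      sides.\<close>
    have "P $$ (k, l) * d lam l = d \<mu> k * P $$ (k, l)" if kl: "k < ?n" "l < ?n" for k l
    proof -
      from kl(1) obtain n \<tau> where k: "n < N" "\<tau> < T" "k = N * \<tau> + n" by (rule joint_index_cases)
      from kl(2) obtain m \<sigma> where l: "m < N" "\<sigma> < T" "l = N * \<sigma> + m" by (rule joint_index_cases)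
      have "P $$ (k, l) = (if \<tau> = \<sigma> then Q $$ (n, m) else 0)"
        using k l Q kron_mat_index[of \<tau> "1\<^sub>m T" \<sigma> n Q m] by (simp add: P_def)
      then show ?thesis
        using Q0[of n m] k l by (cases "Q $$ (n, m) = 0") (auto simp: d_def)
    qed
    then show ?thesis
      using P by (auto simp: mat_diag_mult_left[of _ ?n ?n] mat_diag_mult_right[of _ ?n ?n])
  qed
  then have "mat_diag ?n (d \<mu>) = P * mat_diag ?n (d lam) * mat_adjoint P"
    using P PP by (simp add: assoc_mult_mat[of _ ?n ?n _ ?n _ ?n])
  also have "\<dots> = mat_adjoint ?K * joint_filter T U lam h * ?K"
    using U
    by (simp add: PJ joint_filter_def Let_def d_def mat_adjoint_mult[of _ ?n ?n _ ?n] J(1,2) K(1,2)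
        assoc_mult_mat[of _ ?n ?n _ ?n _ ?n] mult_carrier_mat[of _ ?n ?n _ ?n])
  finally show ?thesis
    unfolding diagonalized_by_def using diagonal_mat_mat_diag by metis
qed

text \<open>
  Any reflection of the plane spanned by the basis vectors \<open>n\<close> and \<open>m\<close> with nonzero entries
  would do; the triple 3, 4, 5 keeps the entries rational.
\<close>

definition mixing_mat :: "nat \<Rightarrow> nat \<Rightarrow> nat \<Rightarrow> complex mat" where
  "mixing_mat N n m = mat N N (\<lambda>(i, j).
     if i = n \<and> j = n then 3/5 else if i = m \<and> j = m then - 3/5
     else if i = n \<and> j = m \<or> i = m \<and> j = n then 4/5 else if i = j then 1 else 0)"

text \<open>The matrix is real symmetric and an involution, because 9/25 + 16/25 = 1 and the mixed
  terms cancel.\<close>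

lemma unitary_mixing_mat:
  assumes "n < N" "m < N" "n \<noteq> m"
  shows "unitary_mat N (mixing_mat N n m)"
proof (rule unitary_matI)
  let ?R = "mixing_mat N n m"
  have "mat_adjoint ?R = ?R"
    by (rule eq_matI) (auto simp: mat_adjoint_index mixing_mat_def)
  moreover have "?R * ?R = 1\<^sub>m N"
  proof (rule eq_matI)
    fix i j assume "i < dim_row (1\<^sub>m N :: complex mat)" "j < dim_col (1\<^sub>m N :: complex mat)"
    then have ij: "i < N" "j < N" by auto
    \<comment> \<open>\<open>K\<close> contains the support of row \<open>i\<close>, so the sum
      collapses to at most two terms.\<close>
    define K where "K = (if i \<in> {n, m} then {n, m} else {i})"
    have "(?R * ?R) $$ (i, j) = (\<Sum>k<N. ?R $$ (i, k) * ?R $$ (k, j))"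
      using ij by (simp add: mixing_mat_def scalar_prod_def atLeast0LessThan)
    also have "\<dots> = (\<Sum>k\<in>K. ?R $$ (i, k) * ?R $$ (k, j))"
      using assms ij by (intro sum.mono_neutral_right) (auto simp: K_def mixing_mat_def)
    also have "\<dots> = 1\<^sub>m N $$ (i, j)"
      using assms ij by (auto simp: K_def mixing_mat_def)
    finally show "(?R * ?R) $$ (i, j) = 1\<^sub>m N $$ (i, j)" .
  qed (auto simp: mixing_mat_def)
  ultimately show "mat_adjoint ?R * ?R = 1\<^sub>m N" by simp
qed (simp add: mixing_mat_def)

text \<open>On the plane being reflected the eigenvalue matrix is a scalar, so it commutes with the
  reflection.\<close>

lemma graph_fourier_basis_mixing:
  assumes "dim_row W = N" "graph_fourier_basis W U lam"
    and "n < N" "m < N" "n \<noteq> m" "lam n = lam m"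
  shows "graph_fourier_basis W (U * mixing_mat N n m) lam"
proof -
  let ?R = "mixing_mat N n m" and ?\<Lambda> = "mat_diag N (\<lambda>n. complex_of_real (lam n))"
  have uU: "unitary_mat N U" and L: "graph_laplacian W = U * ?\<Lambda> * mat_adjoint U"
    using assms by (auto simp: graph_fourier_basis_def)
  note U = unitary_matD[OF uU] and uR = unitary_mixing_mat[OF assms(3-5)]
  note R = unitary_matD[OF uR]
  have "?R * ?\<Lambda> = ?\<Lambda> * ?R"
    using assms R by (auto simp: mat_diag_mult_left[of _ N N] mat_diag_mult_right[of _ N N] mixing_mat_def
        intro!: eq_matI)
  then have "?R * ?\<Lambda> * mat_adjoint ?R = ?\<Lambda>"
    using R by (simp add: assoc_mult_mat[of _ N N _ N _ N])
  moreover have "(U * ?R) * ?\<Lambda> * mat_adjoint (U * ?R) = U * (?R * ?\<Lambda> * mat_adjoint ?R) * mat_adjoint U"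
    by (simp only: mat_adjoint_mult[of _ N N _ N] assoc_mult_mat[of _ N N _ N _ N] U(1,2) R(1,2)
        mult_carrier_mat[of _ N N _ N] mat_diag_dim)
  ultimately show ?thesis
    using L unitary_mat_mult[OF uU uR] assms(1) by (simp add: graph_fourier_basis_def)
qed

text \<open>With \<open>P\<close> the change from the original joint basis to the mixed one,
  \<open>B * P = P * C\<close> for diagonal \<open>B\<close> and \<open>C\<close>. Each nonzero
  entry of \<open>P\<close> then equates an entry of \<open>B\<close> with one of
  \<open>C\<close>.\<close>

lemma diagonal_entries_eq:
  assumes "T \<ge> 1" "dim_row W = N" "graph_fourier_basis W U lam"
    and A: "A \<in> carrier_mat (N * T) (N * T)"
    and diag: "\<And>V \<mu>. graph_fourier_basis W V \<mu> \<Longrightarrow> diagonalized_by (joint_fourier_basis T V) A"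
    and nm: "n < N" "m < N" "lam n = lam m" and \<tau>: "\<tau> < T"
  defines "B \<equiv> mat_adjoint (joint_fourier_basis T U) * A * joint_fourier_basis T U"
  shows "B $$ (N * \<tau> + n, N * \<tau> + n) = B $$ (N * \<tau> + m, N * \<tau> + m)"
proof (cases "n = m")
  case False
  let ?n = "N * T" and ?R = "mixing_mat N n m"
  let ?J = "joint_fourier_basis T U" and ?K = "joint_fourier_basis T (U * ?R)"
  have uU: "unitary_mat N U" using assms by (auto simp: graph_fourier_basis_def)
  note uR = unitary_mixing_mat[OF nm(1,2) False]
  note uV = unitary_mat_mult[OF uU uR]
  note U = unitary_matD[OF uU] and R = unitary_matD[OF uR]
  note J = unitary_matD[OF unitary_joint_fourier_basis[OF assms(1) uU]]
    and K = unitary_matD[OF unitary_joint_fourier_basis[OF assms(1) uV]]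
  define P where "P = mat_adjoint ?J * ?K"
  have P: "P = kron_mat (1\<^sub>m T) ?R"
    using U R by (simp add: P_def adjoint_joint_fourier_basis_mult[OF assms(1) uV uU]
        assoc_mult_mat[of _ N N _ N _ N, symmetric])
  have Pc: "P \<in> carrier_mat ?n ?n" using J K by (auto simp: P_def)
  define C where "C = mat_adjoint ?K * A * ?K"
  have Bc: "B \<in> carrier_mat ?n ?n" and Cc: "C \<in> carrier_mat ?n ?n"
    using J K A by (auto simp: B_def C_def)
  have B: "B = mat_diag ?n (\<lambda>k. B $$ (k, k))"
    using diag[OF assms(3)] Bc by (intro diagonal_mat_eq_mat_diag) (auto simp: diagonalized_by_def B_def)
  have C: "C = mat_diag ?n (\<lambda>k. C $$ (k, k))"
    using diag[OF graph_fourier_basis_mixing[OF assms(2,3) nm(1,2) False nm(3)]] Cc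
    by (intro diagonal_mat_eq_mat_diag) (auto simp: diagonalized_by_def C_def)
  have "B * P = mat_adjoint ?J * A * ((?J * mat_adjoint ?J) * ?K)"
    unfolding B_def P_def
    by (simp only: assoc_mult_mat[of _ ?n ?n _ ?n _ ?n] J(1,2) K(1,2) A mult_carrier_mat[of _ ?n ?n _ ?n])
  also have "\<dots> = mat_adjoint ?J * ((?K * mat_adjoint ?K) * A * ?K)"
    using J K A by (simp add: assoc_mult_mat[of _ ?n ?n _ ?n _ ?n])
  also have "\<dots> = P * C"
    unfolding C_def P_def
    by (simp only: assoc_mult_mat[of _ ?n ?n _ ?n _ ?n] J(1,2) K(1,2) A mult_carrier_mat[of _ ?n ?n _ ?n])
  finally have BP: "mat_diag ?n (\<lambda>k. B $$ (k, k)) * P = P * mat_diag ?n (\<lambda>k. C $$ (k, k))"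
    using B C by simp
  have BC: "B $$ (k, k) = C $$ (l, l)" if "k < ?n" "l < ?n" "P $$ (k, l) \<noteq> 0" for k l
    using that Pc arg_cong[OF BP, of "\<lambda>A. A $$ (k, l)"]
    by (simp add: mat_diag_mult_left[of _ ?n ?n] mat_diag_mult_right[of _ ?n ?n])
  have "P $$ (N * \<tau> + i, N * \<tau> + j) = ?R $$ (i, j)" if "i < N" "j < N" for i j
    using kron_mat_index[of \<tau> "1\<^sub>m T" \<tau> i ?R j] that \<tau> R by (simp add: P)
  \<comment> \<open>These entries, 3/5 and 4/5, lie in the same column, so both entries of
    \<open>B\<close> equal the same entry of \<open>C\<close>.\<close>
  then have "P $$ (N * \<tau> + n, N * \<tau> + n) \<noteq> 0" "P $$ (N * \<tau> + m, N * \<tau> + n) \<noteq> 0"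
    using nm False by (auto simp: mixing_mat_def)
  with BC nm \<tau> show ?thesis by (metis joint_index_less)
qed simp

text \<open>With repeated graph eigenvalues diagonality in a single eigenbasis is too weak, so the
  general equivalence ranges over all of them. For a simple spectrum the given basis is
  enough.\<close>

theorem theorem1:
  fixes M :: "'a measure" and N T :: nat and W :: "real mat"
    and U\<^sub>G :: "complex mat" and lam :: "nat \<Rightarrow> real" and X :: "'a \<Rightarrow> real mat"
  assumes "adjacency_matrix N W"
    and "graph_fourier_basis W U\<^sub>G lam"
    and "T \<ge> 1"
    and "time_vertex_process M N T X"
  shows
    "(jwss M N T W U\<^sub>G lam X \<longleftrightarrow>
        joint_laplacian T W *\<^sub>v mean_vec M (N * T) (vec_process X) = 0\<^sub>v (N * T) \<and>
        (\<forall>V \<mu>. graph_fourier_basis W V \<mu> \<longrightarrow>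
           diagonalized_by (joint_fourier_basis T V) (covariance_mat M (N * T) (vec_process X))))
     \<and>
     (inj_on lam {..<N} \<longrightarrow>
       (jwss M N T W U\<^sub>G lam X \<longleftrightarrow>
          joint_laplacian T W *\<^sub>v mean_vec M (N * T) (vec_process X) = 0\<^sub>v (N * T) \<and>
          diagonalized_by (joint_fourier_basis T U\<^sub>G) (covariance_mat M (N * T) (vec_process X))))"
proof -
  let ?S = "covariance_mat M (N * T) (vec_process X)"
  let ?mean = "joint_laplacian T W *\<^sub>v mean_vec M (N * T) (vec_process X) = 0\<^sub>v (N * T)"
  let ?B = "mat_adjoint (joint_fourier_basis T U\<^sub>G) * ?S * joint_fourier_basis T U\<^sub>G"
  have W: "dim_row W = N" using assms(1) by (auto simp: adjacency_matrix_def)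
  have U: "unitary_mat N U\<^sub>G" using assms(2) W by (simp add: graph_fourier_basis_def)
  note S = covariance_mat_symmetric[of M "N * T" "vec_process X"]
  have jwss: "jwss M N T W U\<^sub>G lam X \<longleftrightarrow> ?mean \<and> (\<exists>h. ?S = joint_filter T U\<^sub>G lam h)"
    unfolding jwss_def Let_def rows_eq_localization_iff[OF assms(3) U S(1,2)] ..
  note filter_iff = joint_filter_exists_iff[OF assms(3) U S(1,3), of lam]
  have "(\<exists>h. ?S = joint_filter T U\<^sub>G lam h) \<longleftrightarrow>
      (\<forall>V \<mu>. graph_fourier_basis W V \<mu> \<longrightarrow> diagonalized_by (joint_fourier_basis T V) ?S)"
  proof
    assume "\<exists>h. ?S = joint_filter T U\<^sub>G lam h"
    then show "\<forall>V \<mu>. graph_fourier_basis W V \<mu> \<longrightarrow> diagonalized_by (joint_fourier_basis T V) ?S"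
      using joint_filter_diagonalized[OF assms(3) W assms(2)] by metis
  next
    \<comment> \<open>The given basis supplies diagonality, and its mixed versions supply equal
      entries at repeated eigenvalues.\<close>
    assume *: "\<forall>V \<mu>. graph_fourier_basis W V \<mu> \<longrightarrow> diagonalized_by (joint_fourier_basis T V) ?S"
    then show "\<exists>h. ?S = joint_filter T U\<^sub>G lam h"
      unfolding filter_iff
      using diagonal_entries_eq[OF assms(3) W assms(2) S(1)] assms(2) by blast
  qed
  \<comment> \<open>Injectivity of \<open>lam\<close> forces \<open>n = m\<close>, making the
    consistency condition in \<open>filter_iff\<close> trivial.\<close>
  moreover have "(\<exists>h. ?S = joint_filter T U\<^sub>G lam h) \<longleftrightarrow>
      diagonalized_by (joint_fourier_basis T U\<^sub>G) ?S" if "inj_on lam {..<N}"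
    using that unfolding filter_iff by (auto dest: inj_onD)
  ultimately show ?thesis unfolding jwss by blast
qed

end
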